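(* Assume that $A\in\mathcal{W}$ and let $J\subset I$. Then any $x\in\ell^2(I)$ can be recovered from the samples $Y_J(x)=\{(Ax)(j)\}_{j\in J}\cup\{x(j)\}_{j\in I\setminus J}$. Conversely, if $A$ is a matrix indexed by $I$ and the maps $x\mapsto Y_J(x)$ are injective and uniformly bounded for all $J\subset I$, then $A\in\mathcal{W}$.
   Context: Let $I$ be a countable index set. For a complex matrix $A=(a_{i,j})_{i,j\in I}$, its central sub-matrices are the matrices $A_J:=(a_{i,j})_{i,j\in J}$, where $J$ is any subset of $I$. The class $\mathcal{W}$ is the set of matrices in $\ell^2(I)$ (complex matrices indexed by $I$, acting on $\ell^2(I)$) such that all of their central sub-matrices are invertible (with $A_J$ acting on $\ell^2(J)$). For a matrix $A$ indexed by $I$, a subset $J\subset I$ and $x\in\ell^2(I)$, the samples $Y_J(x)$ are regarded as the sequence indexed by $I$ whose $j$-th entry is $(Ax)(j)$ if $j\in J$ and $x(j)$ if $j\in I\setminus J$.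
   Formalization: In the converse, "uniformly bounded" is taken two-sidedly: c‖x‖ ≤ ‖Y_J(x)‖ ≤ C‖x‖ with c>0 and C independent of J. With only the upper bound it fails: A=diag(1/(n+1)) has injective Y_J of norm ≤1 but is not invertible on ℓ². *)

theory Defs
  imports "HOL-Analysis.Analysis"
begin

type_synonym 'i cseq = "'i \<Rightarrow> complex"
type_synonym 'i cmatrix = "'i \<Rightarrow> 'i \<Rightarrow> complex"

(* Elements of l2(J) are functions on the whole type that vanish outside J.  For J a subset of I
   this makes l2(J) a subspace of l2(I) by extension by zero. *)
definition l2 :: "'i set \<Rightarrow> 'i cseq set" where
  "l2 J = {x. (\<forall>i. i \<notin> J \<longrightarrow> x i = 0) \<and> (\<lambda>i. (cmod (x i))\<^sup>2) summable_on J}"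

definition l2_norm :: "'i set \<Rightarrow> 'i cseq \<Rightarrow> real" where
  "l2_norm J x = sqrt (\<Sum>\<^sub>\<infinity>i\<in>J. (cmod (x i))\<^sup>2)"

definition bounded_op :: "'i set \<Rightarrow> ('i cseq \<Rightarrow> 'i cseq) \<Rightarrow> bool" where
  "bounded_op J T \<longleftrightarrow>
     (\<forall>x\<in>l2 J. T x \<in> l2 J) \<and>
     (\<forall>x\<in>l2 J. \<forall>y\<in>l2 J. T (\<lambda>i. x i + y i) = (\<lambda>i. T x i + T y i)) \<and>
     (\<forall>a. \<forall>x\<in>l2 J. T (\<lambda>i. a * x i) = (\<lambda>i. a * T x i)) \<and>
     (\<exists>C. \<forall>x\<in>l2 J. l2_norm J (T x) \<le> C * l2_norm J x)"

(* Action on sequences of the central sub-matrix of A with rows and columns in J; for J = I it is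
   the action of A itself.  Entries of A outside J \<times> J are never used. *)
definition sub_apply :: "'i set \<Rightarrow> 'i cmatrix \<Rightarrow> 'i cseq \<Rightarrow> 'i cseq" where
  "sub_apply J A x = (\<lambda>i. if i \<in> J then \<Sum>\<^sub>\<infinity>j\<in>J. A i j * x j else 0)"

(* infsum is 0 for divergent sums, so convergence of the row sums is a separate requirement. *)
definition rows_summable :: "'i set \<Rightarrow> 'i cmatrix \<Rightarrow> bool" where
  "rows_summable J A \<longleftrightarrow> (\<forall>x\<in>l2 J. \<forall>i\<in>J. (\<lambda>j. A i j * x j) summable_on J)"

definition l2_matrix :: "'i set \<Rightarrow> 'i cmatrix \<Rightarrow> bool" where
  "l2_matrix J A \<longleftrightarrow> rows_summable J A \<and> bounded_op J (sub_apply J A)"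

definition sub_invertible :: "'i set \<Rightarrow> 'i cmatrix \<Rightarrow> bool" where
  "sub_invertible J A \<longleftrightarrow>
     l2_matrix J A \<and>
     (\<exists>T. bounded_op J T \<and>
          (\<forall>x\<in>l2 J. T (sub_apply J A x) = x \<and> sub_apply J A (T x) = x))"

definition class_W :: "'i set \<Rightarrow> 'i cmatrix set" where
  "class_W I = {A. l2_matrix I A \<and> (\<forall>J\<subseteq>I. sub_invertible J A)}"

definition samples :: "'i set \<Rightarrow> 'i cmatrix \<Rightarrow> 'i set \<Rightarrow> 'i cseq \<Rightarrow> 'i cseq" where
  "samples I A J x = (\<lambda>j. if j \<in> J then sub_apply I A x j else x j)"

(* Uniform boundedness of the sampling maps is understood in the sense of stable sampling: two-sided,
   with both constants independent of J.  An upper bound alone, even with injectivity, would not give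
   membership in the class W: for the diagonal matrix with entries 1/(n+1) on the naturals all
   sampling maps are injective with norm at most 1, but the matrix has no bounded inverse. *)
definition samples_uniformly_bounded :: "'i set \<Rightarrow> 'i cmatrix \<Rightarrow> bool" where
  "samples_uniformly_bounded I A \<longleftrightarrow>
     (\<exists>c C. 0 < c \<and>
        (\<forall>J\<subseteq>I. \<forall>x\<in>l2 I. samples I A J x \<in> l2 I \<and>
            c * l2_norm I x \<le> l2_norm I (samples I A J x) \<and>
            l2_norm I (samples I A J x) \<le> C * l2_norm I x))"

end

theory Submission
  imports Defs
begin

text \<open>
  The first half is linear algebra: if two sequences have the same samples, their difference \<open>z\<close>
  vanishes outside \<open>J\<close> and satisfies \<open>A\<^sub>J z = 0\<close>, so \<open>z = 0\<close> because \<open>A\<^sub>J\<close> is invertible.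

  For the converse, let \<open>c > 0\<close> be the lower constant of the sampling maps. On \<open>l2 J\<close> the map \<open>Y\<^sub>J\<close>
  is \<open>A\<^sub>J\<close>, so every central sub-matrix satisfies \<open>c \<parallel>x\<parallel> \<le> \<parallel>A\<^sub>J x\<parallel>\<close>. This makes \<open>A\<^sub>J\<close> injective with
  closed range, and any inverse is automatically bounded by \<open>1/c\<close>. The point of the proof is that
  \<open>A\<^sub>J\<close> is onto. For a single operator the lower bound does not give this (the unilateral shift is an
  isometry); what gives it is that the bound holds for all the finite sub-matrices with the same
  constant. Given \<open>y\<close> in \<open>l2 J\<close> and a finite \<open>F \<subseteq> J\<close>, the finite system \<open>A\<^sub>F x = y\<close> on \<open>F\<close> has a solution
  (\<open>finite_section_solvable\<close>), and this solution lies in the ball of radius \<open>\<parallel>y\<parallel>/c\<close>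
  whatever \<open>F\<close> is. That ball is compact for pointwise convergence (\<open>compact_l2_ball\<close>). The rows
  of \<open>A\<close> are square summable (\<open>row_square_summable\<close>), so each equation of the system defines
  a closed subset of the ball (\<open>continuous_on_l2_ball_functional\<close>). Any finitely many equations can be
  solved together inside the ball, hence by the finite intersection property all of them can
  (\<open>solution_from_finite_sections\<close>).
\<close>

section \<open>Square summable sequences\<close>

text \<open>Membership in \<open>l2\<close> together with a norm bound is a condition on finite partial sums only. In
  this form it visibly passes to pointwise limits.\<close>

lemma l2_ball_iff:
  "x \<in> l2 J \<and> l2_norm J x \<le> B \<longleftrightarrow>
     (\<forall>i. i \<notin> J \<longrightarrow> x i = 0) \<and> (\<forall>F. finite F \<and> F \<subseteq> J \<longrightarrow> L2_set (\<lambda>i. cmod (x i)) F \<le> B)"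
  (is "?L \<longleftrightarrow> ?R")
proof
  assume L: ?L
  then have s: "(\<lambda>i. (cmod (x i))\<^sup>2) summable_on J" by (simp add: l2_def)
  have "L2_set (\<lambda>i. cmod (x i)) F \<le> B" if "finite F" "F \<subseteq> J" for F
  proof -
    have "L2_set (\<lambda>i. cmod (x i)) F \<le> l2_norm J x"
      unfolding L2_set_def l2_norm_def
      by (intro real_sqrt_le_mono finite_sum_le_infsum s that) auto
    then show ?thesis using L by simp
  qed
  then show ?R using L by (auto simp: l2_def)
next
  assume R: ?R
  then have "0 \<le> B" by (metis L2_set_empty empty_subsetI finite.emptyI)
  have bd: "(\<Sum>i\<in>F. (cmod (x i))\<^sup>2) \<le> B\<^sup>2" if "finite F" "F \<subseteq> J" for F
  proof -
    have "sqrt (\<Sum>i\<in>F. (cmod (x i))\<^sup>2) \<le> B" using R that by (simp add: L2_set_def)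
    then show ?thesis by (simp add: sqrt_le_D)
  qed
  have s: "(\<lambda>i. (cmod (x i))\<^sup>2) summable_on J"
    by (rule nonneg_bdd_above_summable_on) (auto intro!: bdd_aboveI2[where M = "B\<^sup>2"] bd)
  have "(\<Sum>\<^sub>\<infinity>i\<in>J. (cmod (x i))\<^sup>2) \<le> B\<^sup>2"
    by (rule infsum_le_finite_sums[OF s bd])
  then have "l2_norm J x \<le> B"
    unfolding l2_norm_def using \<open>0 \<le> B\<close> by (simp add: real_le_lsqrt infsum_nonneg)
  then show ?L using R s by (auto simp: l2_def)
qed

lemma L2_set_le_l2_norm:
  assumes "x \<in> l2 J" "finite F" "F \<subseteq> J"
  shows "L2_set (\<lambda>i. cmod (x i)) F \<le> l2_norm J x"
  using l2_ball_iff[of x J "l2_norm J x"] assms by blast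

lemma l2_norm_nonneg: "0 \<le> l2_norm J x"
  by (simp add: l2_norm_def infsum_nonneg)

lemma l2_mono:
  assumes "J \<subseteq> I" "x \<in> l2 J"
  shows "x \<in> l2 I" "l2_norm I x = l2_norm J x"
proof -
  have z: "\<And>i. i \<notin> J \<Longrightarrow> x i = 0" using assms by (simp add: l2_def)
  have "(\<lambda>i. (cmod (x i))\<^sup>2) summable_on I \<longleftrightarrow> (\<lambda>i. (cmod (x i))\<^sup>2) summable_on J"
    by (rule summable_on_cong_neutral) (use z assms in auto)
  then show "x \<in> l2 I" using assms by (auto simp: l2_def)
  have "(\<Sum>\<^sub>\<infinity>i\<in>I. (cmod (x i))\<^sup>2) = (\<Sum>\<^sub>\<infinity>i\<in>J. (cmod (x i))\<^sup>2)"
    by (rule infsum_cong_neutral) (use z assms in auto)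
  then show "l2_norm I x = l2_norm J x" by (simp add: l2_norm_def)
qed

lemma l2_restrict:
  assumes "J \<subseteq> I" "x \<in> l2 I"
  shows "(\<lambda>i. if i \<in> J then x i else 0) \<in> l2 J"
    and "l2_norm J (\<lambda>i. if i \<in> J then x i else 0) \<le> l2_norm I x"
proof -
  have "L2_set (\<lambda>i. cmod (if i \<in> J then x i else 0)) F \<le> l2_norm I x"
    if "finite F" "F \<subseteq> J" for F
  proof -
    have "L2_set (\<lambda>i. cmod (if i \<in> J then x i else 0)) F = L2_set (\<lambda>i. cmod (x i)) F"
      by (rule L2_set_cong) (use that in auto)
    then show ?thesis using L2_set_le_l2_norm[OF assms(2), of F] that assms(1) by auto
  qed
  then show "(\<lambda>i. if i \<in> J then x i else 0) \<in> l2 J"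
    and "l2_norm J (\<lambda>i. if i \<in> J then x i else 0) \<le> l2_norm I x"
    using l2_ball_iff[of "\<lambda>i. if i \<in> J then x i else 0" J "l2_norm I x"] by auto
qed

lemma l2_add:
  assumes "x \<in> l2 J" "y \<in> l2 J"
  shows "(\<lambda>i. x i + y i) \<in> l2 J"
proof -
  have "L2_set (\<lambda>i. cmod (x i + y i)) F \<le> l2_norm J x + l2_norm J y"
    if "finite F" "F \<subseteq> J" for F
  proof -
    have "L2_set (\<lambda>i. cmod (x i + y i)) F \<le> L2_set (\<lambda>i. cmod (x i) + cmod (y i)) F"
      by (rule L2_set_mono) (auto intro: norm_triangle_ineq)
    also have "\<dots> \<le> L2_set (\<lambda>i. cmod (x i)) F + L2_set (\<lambda>i. cmod (y i)) F"
      by (rule L2_set_triangle_ineq)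
    finally show ?thesis
      using L2_set_le_l2_norm[OF assms(1) that] L2_set_le_l2_norm[OF assms(2) that] by linarith
  qed
  then show ?thesis
    using l2_ball_iff[of "\<lambda>i. x i + y i" J "l2_norm J x + l2_norm J y"] assms
    by (auto simp: l2_def)
qed

lemma l2_scale:
  assumes "x \<in> l2 J"
  shows "(\<lambda>i. a * x i) \<in> l2 J"
  using assms by (auto simp: l2_def norm_mult power_mult_distrib intro: summable_on_cmult_right)

lemma l2_diff:
  assumes "x \<in> l2 J" "y \<in> l2 J"
  shows "(\<lambda>i. x i - y i) \<in> l2 J"
  using l2_add[OF assms(1) l2_scale[OF assms(2), of "-1"]] by simp

lemma l2_norm_zero_imp_zero:
  assumes "x \<in> l2 J" "l2_norm J x \<le> 0"
  shows "x = (\<lambda>_. 0)"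
proof
  fix i
  show "x i = 0"
  proof (cases "i \<in> J")
    case True
    then have "cmod (x i) \<le> l2_norm J x"
      using L2_set_le_l2_norm[OF assms(1), of "{i}"] by (simp add: L2_set_def)
    then have "cmod (x i) \<le> 0" using assms(2) by (rule order_trans)
    then show ?thesis by simp
  qed (use assms in \<open>auto simp: l2_def\<close>)
qed

lemma l2_finite_support:
  assumes "finite F" "\<And>i. i \<notin> F \<Longrightarrow> x i = 0"
  shows "x \<in> l2 F" "l2_norm F x = L2_set (\<lambda>i. cmod (x i)) F"
  using assms by (auto simp: l2_def l2_norm_def L2_set_def)

section \<open>Central sub-matrices as operators\<close>

lemma sub_apply_add:
  assumes "rows_summable J A" "x \<in> l2 J" "y \<in> l2 J"
  shows "sub_apply J A (\<lambda>i. x i + y i) = (\<lambda>i. sub_apply J A x i + sub_apply J A y i)"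
  using assms by (auto simp: fun_eq_iff sub_apply_def rows_summable_def ring_distribs intro!: infsum_add)

lemma sub_apply_scale: "sub_apply J A (\<lambda>i. a * x i) = (\<lambda>i. a * sub_apply J A x i)"
  by (auto simp: fun_eq_iff sub_apply_def mult.left_commute infsum_cmult_right')

lemma sub_apply_diff:
  assumes "rows_summable J A" "x \<in> l2 J" "y \<in> l2 J"
  shows "sub_apply J A (\<lambda>i. x i - y i) = (\<lambda>i. sub_apply J A x i - sub_apply J A y i)"
  using sub_apply_add[OF assms(1,2) l2_scale[OF assms(3)], of "-1"] sub_apply_scale[of J A "-1" y]
  by simp

lemma sub_apply_eq_restrict:
  assumes "J \<subseteq> I" "x \<in> l2 J"
  shows "sub_apply J A x = (\<lambda>i. if i \<in> J then sub_apply I A x i else 0)"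
proof -
  have z: "\<And>i. i \<notin> J \<Longrightarrow> x i = 0" using assms by (simp add: l2_def)
  have "(\<Sum>\<^sub>\<infinity>j\<in>J. A i j * x j) = (\<Sum>\<^sub>\<infinity>j\<in>I. A i j * x j)" for i
    by (rule infsum_cong_neutral) (use z assms in auto)
  then show ?thesis using assms by (auto simp: sub_apply_def fun_eq_iff)
qed

lemma samples_eq_sub_apply:
  assumes "J \<subseteq> I" "x \<in> l2 J"
  shows "samples I A J x = sub_apply J A x"
  using assms by (auto simp: sub_apply_eq_restrict[OF assms] samples_def l2_def fun_eq_iff)

lemma l2_matrix_sub:
  assumes "l2_matrix I A" "J \<subseteq> I"
  shows "l2_matrix J A"
proof -
  have rI: "rows_summable I A" and bI: "bounded_op I (sub_apply I A)"
    using assms by (auto simp: l2_matrix_def)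
  have r: "rows_summable J A"
    unfolding rows_summable_def
  proof (intro ballI)
    fix x i assume "x \<in> l2 J" "i \<in> J"
    then have "(\<lambda>j. A i j * x j) summable_on I"
      using rI assms(2) l2_mono(1)[OF assms(2)] by (auto simp: rows_summable_def)
    then show "(\<lambda>j. A i j * x j) summable_on J"
      using assms(2) by (rule summable_on_subset_banach)
  qed
  obtain C where C: "\<forall>x\<in>l2 I. l2_norm I (sub_apply I A x) \<le> C * l2_norm I x"
    using bI by (auto simp: bounded_op_def)
  have m: "sub_apply I A x \<in> l2 I" if "x \<in> l2 I" for x using bI that by (auto simp: bounded_op_def)
  have "sub_apply J A x \<in> l2 J" "l2_norm J (sub_apply J A x) \<le> C * l2_norm J x"
    if "x \<in> l2 J" for x
  proof -
    have x: "x \<in> l2 I" "l2_norm I x = l2_norm J x" using l2_mono[OF assms(2) that] by auto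
    show "sub_apply J A x \<in> l2 J"
      using l2_restrict(1)[OF assms(2) m[OF x(1)]] sub_apply_eq_restrict[OF assms(2) that, of A] by simp
    show "l2_norm J (sub_apply J A x) \<le> C * l2_norm J x"
      using l2_restrict(2)[OF assms(2) m[OF x(1)]] sub_apply_eq_restrict[OF assms(2) that, of A]
        C x by fastforce
  qed
  then have "bounded_op J (sub_apply J A)"
    unfolding bounded_op_def using sub_apply_add[OF r] sub_apply_scale by blast
  with r show ?thesis by (simp add: l2_matrix_def)
qed

text \<open>Testing a row functional, which is bounded, on its own conjugate truncated to a finite set
  bounds the square sums of the row.\<close>

lemma row_square_summable:
  assumes "l2_matrix J A" "i \<in> J"
  shows "(\<lambda>j. (cmod (A i j))\<^sup>2) summable_on J"
proof -
  obtain C where C: "\<forall>x\<in>l2 J. l2_norm J (sub_apply J A x) \<le> C * l2_norm J x"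
    and m: "\<forall>x\<in>l2 J. sub_apply J A x \<in> l2 J"
    using assms by (auto simp: bounded_op_def l2_matrix_def)
  have "(\<Sum>j\<in>G. (cmod (A i j))\<^sup>2) \<le> C\<^sup>2" if G: "finite G" "G \<subseteq> J" for G
  proof -
    define x where "x = (\<lambda>j. if j \<in> G then cnj (A i j) else 0)"
    define s where "s = L2_set (\<lambda>j. cmod (A i j)) G"
    have "x \<in> l2 G" by (rule l2_finite_support) (auto simp: x_def G)
    moreover have "l2_norm G x = s"
      by (subst l2_finite_support) (auto simp: x_def G s_def intro!: L2_set_cong)
    ultimately have x: "x \<in> l2 J" "l2_norm J x = s" using l2_mono[OF G(2)] by auto
    have s2: "s\<^sup>2 = (\<Sum>j\<in>G. (cmod (A i j))\<^sup>2)"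
      by (simp add: s_def L2_set_def sum_nonneg)
    have "sub_apply J A x i = (\<Sum>\<^sub>\<infinity>j\<in>J. A i j * x j)" using assms by (simp add: sub_apply_def)
    also have "\<dots> = (\<Sum>\<^sub>\<infinity>j\<in>G. A i j * x j)"
      by (rule infsum_cong_neutral) (use G in \<open>auto simp: x_def\<close>)
    also have "\<dots> = (\<Sum>j\<in>G. A i j * cnj (A i j))" using G by (auto simp: x_def)
    also have "\<dots> = of_real (s\<^sup>2)"
      unfolding s2 of_real_sum by (intro sum.cong refl) (simp only: complex_norm_square)
    finally have "cmod (sub_apply J A x i) = s\<^sup>2" by (simp add: norm_power)
    moreover have "cmod (sub_apply J A x i) \<le> l2_norm J (sub_apply J A x)"
      using L2_set_le_l2_norm[of "sub_apply J A x" J "{i}"] m x(1) assms(2) by (simp add: L2_set_def)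
    ultimately have "s * s \<le> C * s" using C x by (fastforce simp: power2_eq_square)
    moreover have "0 \<le> s" by (simp add: s_def)
    ultimately have "s \<le> \<bar>C\<bar>" by (cases "s = 0") (auto simp: mult_le_cancel_right)
    then have "s\<^sup>2 \<le> C\<^sup>2" using \<open>0 \<le> s\<close> by (simp add: abs_le_square_iff[symmetric])
    then show ?thesis by (simp add: s2)
  qed
  then show ?thesis
    by (intro nonneg_bdd_above_summable_on) (auto intro!: bdd_aboveI2[where M = "C\<^sup>2"])
qed

section \<open>Finite systems\<close>

text \<open>Gaussian elimination, adding one index \<open>k\<close> at a time. Solve the smaller system for the right-hand
  side \<open>y\<close> (solution \<open>u\<close>) and for the \<open>k\<close>-th column (solution \<open>v\<close>). Then \<open>u + t (e\<^sub>k - v)\<close> solves the old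
  equations for every \<open>t\<close>, and the new equation determines \<open>t\<close> unless its pivot vanishes. If
  the pivot vanishes, then \<open>e\<^sub>k - v\<close> is a nonzero kernel vector of the larger matrix.\<close>

lemma finite_section_solvable:
  fixes A :: "'i cmatrix"
  assumes "finite F"
    and "\<And>G z. G \<subseteq> F \<Longrightarrow> (\<And>i. i \<notin> G \<Longrightarrow> z i = 0) \<Longrightarrow>
           (\<And>i. i \<in> G \<Longrightarrow> (\<Sum>j\<in>G. A i j * z j) = 0) \<Longrightarrow> z = (\<lambda>_. 0)"
  shows "\<exists>x. (\<forall>i. i \<notin> F \<longrightarrow> x i = 0) \<and> (\<forall>i\<in>F. (\<Sum>j\<in>F. A i j * x j) = y i)"
  using assms
proof (induction F arbitrary: y rule: finite_induct)
  case empty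
  show ?case by (rule exI[of _ "\<lambda>_. 0"]) simp
next
  case (insert k F)
  have IH: "\<exists>x. (\<forall>i. i \<notin> F \<longrightarrow> x i = 0) \<and> (\<forall>i\<in>F. (\<Sum>j\<in>F. A i j * x j) = y i)" for y
  proof (rule insert.IH)
    fix G z
    assume "G \<subseteq> F" "\<And>i. i \<notin> G \<Longrightarrow> z i = 0" "\<And>i. i \<in> G \<Longrightarrow> (\<Sum>j\<in>G. A i j * z j) = 0"
    then show "z = (\<lambda>_. 0)" using insert.prems[OF subset_insertI2[of G F k], of z] by blast
  qed
  obtain u where u: "\<And>i. i \<notin> F \<Longrightarrow> u i = 0" "\<And>i. i \<in> F \<Longrightarrow> (\<Sum>j\<in>F. A i j * u j) = y i"
    using IH[of y] by blast
  obtain v where v: "\<And>i. i \<notin> F \<Longrightarrow> v i = 0" "\<And>i. i \<in> F \<Longrightarrow> (\<Sum>j\<in>F. A i j * v j) = A i k"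
    using IH[of "\<lambda>i. A i k"] by blast
  define s where "s = A k k - (\<Sum>j\<in>F. A k j * v j)"
  \<comment> \<open>The value \<open>r = 1\<close> gives the candidate solutions \<open>u + t (e\<^sub>k - v)\<close>, and \<open>w 0 1\<close> is the kernel
    vector \<open>e\<^sub>k - v\<close>.\<close>
  define w where "w r t = (\<lambda>i. r * u i + t * ((if i = k then 1 else 0) - v i))" for r t :: complex
  have w0: "w r t i = 0" if "i \<notin> insert k F" for r t i
    using that u(1) v(1) by (auto simp: w_def)
  have wsum: "(\<Sum>j\<in>insert k F. A i j * w r t j) =
      r * (\<Sum>j\<in>F. A i j * u j) + t * (A i k - (\<Sum>j\<in>F. A i j * v j))" for r t i
  proof -
    have "(\<Sum>j\<in>F. A i j * w r t j) = (\<Sum>j\<in>F. r * (A i j * u j) - t * (A i j * v j))"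
      by (rule sum.cong) (use insert.hyps in \<open>auto simp: w_def algebra_simps\<close>)
    also have "\<dots> = r * (\<Sum>j\<in>F. A i j * u j) - t * (\<Sum>j\<in>F. A i j * v j)"
      by (simp add: sum_subtractf sum_distrib_left)
    moreover have "w r t k = t" using insert.hyps u(1)[of k] v(1)[of k] by (simp add: w_def)
    ultimately show ?thesis using insert.hyps by (simp add: algebra_simps)
  qed
  have "s \<noteq> 0"
  proof
    assume "s = 0"
    have "w 0 1 = (\<lambda>_. 0)"
    proof (rule insert.prems)
      show "(\<Sum>j\<in>insert k F. A i j * w 0 1 j) = 0" if "i \<in> insert k F" for i
        using that \<open>s = 0\<close> v(2) by (auto simp: wsum s_def)
    qed (use w0 in auto)
    then have "w 0 1 k = 0" by simp
    then show False using insert.hyps v(1)[of k] by (simp add: w_def)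
  qed
  define t where "t = (y k - (\<Sum>j\<in>F. A k j * u j)) / s"
  show ?case
  proof (intro exI[of _ "w 1 t"] conjI ballI allI impI)
    fix i assume "i \<in> insert k F"
    then show "(\<Sum>j\<in>insert k F. A i j * w 1 t j) = y i"
      using \<open>s \<noteq> 0\<close> u(2) v(2) by (auto simp: wsum t_def simp flip: s_def)
  qed (use w0 in auto)
qed

section \<open>Compactness and passage to the limit\<close>

lemma square_summable_pairing:
  assumes "\<And>F. finite F \<Longrightarrow> F \<subseteq> S \<Longrightarrow> L2_set (\<lambda>j. cmod (a j)) F \<le> M"
    and "\<And>F. finite F \<Longrightarrow> F \<subseteq> S \<Longrightarrow> L2_set (\<lambda>j. cmod (x j)) F \<le> B"
  shows "(\<lambda>j. a j * x j) summable_on S" "cmod (\<Sum>\<^sub>\<infinity>j\<in>S. a j * x j) \<le> M * B"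
proof -
  have "0 \<le> M" using assms(1)[of "{}"] by simp
  have bd: "(\<Sum>j\<in>F. cmod (a j * x j)) \<le> M * B" if "finite F" "F \<subseteq> S" for F
  proof -
    have "(\<Sum>j\<in>F. cmod (a j * x j)) \<le> L2_set (\<lambda>j. cmod (a j)) F * L2_set (\<lambda>j. cmod (x j)) F"
      using L2_set_mult_ineq[of "\<lambda>j. cmod (a j)" "\<lambda>j. cmod (x j)" F] by (simp add: norm_mult)
    also have "\<dots> \<le> M * B"
      by (intro mult_mono assms that \<open>0 \<le> M\<close>) auto
    finally show ?thesis .
  qed
  have s: "(\<lambda>j. cmod (a j * x j)) summable_on S"
    by (rule nonneg_bdd_above_summable_on) (auto intro!: bdd_aboveI2[where M = "M * B"] bd)
  then show "(\<lambda>j. a j * x j) summable_on S" by (rule abs_summable_summable)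
  have "cmod (\<Sum>\<^sub>\<infinity>j\<in>S. a j * x j) \<le> (\<Sum>\<^sub>\<infinity>j\<in>S. cmod (a j * x j))"
    by (rule norm_infsum_bound[OF s])
  also have "\<dots> \<le> M * B" by (rule infsum_le_finite_sums[OF s bd])
  finally show "cmod (\<Sum>\<^sub>\<infinity>j\<in>S. a j * x j) \<le> M * B" .
qed

definition l2_ball :: "'i set \<Rightarrow> real \<Rightarrow> 'i cseq set" where
  "l2_ball J B = {x \<in> l2 J. l2_norm J x \<le> B}"

lemma closed_l2_ball: "closed (l2_ball J B)"
proof -
  have eq: "l2_ball J B = (\<Inter>i\<in>-J. {x. x i = 0}) \<inter>
      (\<Inter>F\<in>{F. finite F \<and> F \<subseteq> J}. {x. L2_set (\<lambda>i. cmod (x i)) F \<le> B})"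
    using l2_ball_iff[of _ J B] by (auto simp: l2_ball_def)
  have "closed {x :: 'a cseq. x i = 0}" for i
    by (intro closed_Collect_eq continuous_on_product_coordinates continuous_on_const)
  moreover have "closed {x :: 'a cseq. L2_set (\<lambda>i. cmod (x i)) F \<le> B}" for F
    unfolding L2_set_def
    by (intro closed_Collect_le continuous_intros continuous_on_product_coordinates)
  ultimately show ?thesis
    unfolding eq by (intro closed_Int closed_INT ballI) auto
qed

text \<open>The topology on sequences is the product topology, that is, pointwise convergence. The ball is a closed
  part of a product of discs, so this is Tychonoff's theorem; it stands in for the weak compactness of
  the ball of a Hilbert space.\<close>

lemma compact_l2_ball: "compact (l2_ball J B)"
proof -
  have "compactin (product_topology (\<lambda>i :: 'a. euclidean :: complex topology) UNIV)
          (PiE UNIV (\<lambda>_. cball 0 B))"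
    by (simp add: compactin_PiE)
  then have "compact (PiE (UNIV :: 'a set) (\<lambda>_. cball (0 :: complex) B))"
    by (simp add: euclidean_product_topology)
  moreover have "l2_ball J B \<subseteq> PiE UNIV (\<lambda>_. cball 0 B)"
  proof
    fix x assume "x \<in> l2_ball J B"
    then have x: "x \<in> l2 J" "l2_norm J x \<le> B" by (auto simp: l2_ball_def)
    have "cmod (x i) \<le> B" for i
    proof (cases "i \<in> J")
      case True
      then show ?thesis using L2_set_le_l2_norm[OF x(1), of "{i}"] x(2) by (simp add: L2_set_def)
    next
      case False
      then show ?thesis using x l2_norm_nonneg[of J x] by (simp add: l2_def)
    qed
    then show "x \<in> PiE UNIV (\<lambda>_. cball 0 B)" by auto
  qed
  ultimately show ?thesis
    by (metis closed_l2_ball compact_Int_closed inf.absorb_iff2)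
qed

text \<open>On the ball, the Cauchy-Schwarz inequality bounds the error of a partial sum over \<open>G\<close> by \<open>B\<close> times
  the norm of \<open>a\<close> outside \<open>G\<close>. The functional is therefore a uniform limit of finite sums of
  coordinates.\<close>

lemma continuous_on_l2_ball_functional:
  fixes a :: "'i cseq"
  assumes "(\<lambda>j. (cmod (a j))\<^sup>2) summable_on J"
  shows "continuous_on (l2_ball J B) (\<lambda>x. \<Sum>\<^sub>\<infinity>j\<in>J. a j * x j)"
proof (rule uniform_limit_theorem[where f = "\<lambda>G x. \<Sum>j\<in>G. a j * x j"
        and F = "finite_subsets_at_top J"])
  show "\<forall>\<^sub>F G in finite_subsets_at_top J. continuous_on (l2_ball J B) (\<lambda>x. \<Sum>j\<in>G. a j * x j)"
    by (intro always_eventually allI continuous_intros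
          continuous_on_subset[OF continuous_on_product_coordinates]) auto
  show "uniform_limit (l2_ball J B) (\<lambda>G x. \<Sum>j\<in>G. a j * x j) (\<lambda>x. \<Sum>\<^sub>\<infinity>j\<in>J. a j * x j)
          (finite_subsets_at_top J)"
  proof (rule uniform_limitI)
    fix e :: real assume "0 < e"
    \<comment> \<open>\<open>B\<close> may be zero or negative, so the error bound \<open>d * B\<close> is kept below \<open>e\<close> by dividing by
      \<open>\<bar>B\<bar> + 1\<close>.\<close>
    define d where "d = e / (\<bar>B\<bar> + 1)"
    have d: "0 < d" "d * B < e"
    proof -
      show "0 < d" using \<open>0 < e\<close> by (simp add: d_def add_nonneg_pos)
      have "d * B < d * (\<bar>B\<bar> + 1)" using \<open>0 < d\<close> by (intro mult_strict_left_mono) auto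
      then show "d * B < e" by (simp add: d_def)
    qed
    let ?q = "\<lambda>j. (cmod (a j))\<^sup>2"
    have "\<forall>\<^sub>F G in finite_subsets_at_top J. dist (sum ?q G) (infsum ?q J) < d\<^sup>2"
      using d by (intro tendstoD infsum_tendsto assms) auto
    then show "\<forall>\<^sub>F G in finite_subsets_at_top J. \<forall>x\<in>l2_ball J B.
        dist (\<Sum>j\<in>G. a j * x j) (\<Sum>\<^sub>\<infinity>j\<in>J. a j * x j) < e"
    proof (rule eventually_elim2[where Q = "\<lambda>G. finite G \<and> G \<subseteq> J"], goal_cases)
      case 1
      show ?case by (rule eventually_finite_subsets_at_top_weakI) simp
    next
      case (2 G)
      show ?case
      proof
        fix x
        assume "x \<in> l2_ball J B"
        then have G: "finite G" "G \<subseteq> J" and near: "infsum ?q J - sum ?q G < d\<^sup>2"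
          using 2 by (auto simp: dist_real_def)
        have "x \<in> l2 J \<and> l2_norm J x \<le> B"
          using \<open>x \<in> l2_ball J B\<close> by (auto simp: l2_ball_def)
        then have x: "\<And>F. finite F \<Longrightarrow> F \<subseteq> J \<Longrightarrow> L2_set (\<lambda>i. cmod (x i)) F \<le> B"
          unfolding l2_ball_iff by blast
        have aJ: "L2_set (\<lambda>j. cmod (a j)) H \<le> sqrt (infsum ?q J)" if "finite H" "H \<subseteq> J" for H
          unfolding L2_set_def
          by (intro real_sqrt_le_mono finite_sum_le_infsum that assms) auto
        have tail: "L2_set (\<lambda>j. cmod (a j)) H \<le> d" if H: "finite H" "H \<subseteq> J - G" for H
        proof -
          have "sum ?q (G \<union> H) \<le> infsum ?q J"
            using H G by (intro finite_sum_le_infsum assms) auto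
          moreover have "sum ?q (G \<union> H) = sum ?q G + sum ?q H"
            using H G by (intro sum.union_disjoint) auto
          ultimately have "sum ?q H \<le> d\<^sup>2" using near by linarith
          then show ?thesis unfolding L2_set_def using d(1) by (intro real_le_lsqrt sum_nonneg) auto
        qed
        have sJ: "(\<lambda>j. a j * x j) summable_on J"
          by (rule square_summable_pairing(1)[OF aJ x])
        have "(\<Sum>\<^sub>\<infinity>j\<in>J - G. a j * x j) = (\<Sum>\<^sub>\<infinity>j\<in>J. a j * x j) - (\<Sum>j\<in>G. a j * x j)"
          using infsum_Diff[OF sJ summable_on_finite[OF G(1)] G(2)] G(1) by simp
        moreover have "cmod (\<Sum>\<^sub>\<infinity>j\<in>J - G. a j * x j) \<le> d * B"
          by (rule square_summable_pairing(2)[OF tail x]) auto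
        ultimately show "dist (\<Sum>j\<in>G. a j * x j) (\<Sum>\<^sub>\<infinity>j\<in>J. a j * x j) < e"
          using d by (simp add: dist_norm norm_minus_commute)
      qed
    qed
  qed
qed simp

lemma solution_from_finite_sections:
  fixes A :: "'i cmatrix"
  assumes "\<And>i. i \<in> J \<Longrightarrow> (\<lambda>j. (cmod (A i j))\<^sup>2) summable_on J"
    and "\<And>F. finite F \<Longrightarrow> F \<subseteq> J \<Longrightarrow>
           \<exists>x\<in>l2 F. l2_norm F x \<le> B \<and> (\<forall>i\<in>F. (\<Sum>j\<in>F. A i j * x j) = y i)"
  shows "\<exists>x\<in>l2 J. \<forall>i\<in>J. (\<Sum>\<^sub>\<infinity>j\<in>J. A i j * x j) = y i"
proof -
  define E where "E i = l2_ball J B \<inter> (\<lambda>x. \<Sum>\<^sub>\<infinity>j\<in>J. A i j * x j) -` {y i}" for i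
  have "l2_ball J B \<inter> (\<Inter>i\<in>J. E i) \<noteq> {}"
  proof (rule compact_imp_fip_image[OF compact_l2_ball])
    show "closed (E i)" if "i \<in> J" for i
      unfolding E_def
      by (intro continuous_closed_preimage continuous_on_l2_ball_functional closed_l2_ball assms that) auto
  next
    fix F assume F: "finite F" "F \<subseteq> J"
    obtain x where x: "x \<in> l2 F" "l2_norm F x \<le> B" "\<And>i. i \<in> F \<Longrightarrow> (\<Sum>j\<in>F. A i j * x j) = y i"
      using assms(2)[OF F] by blast
    have "x \<in> l2_ball J B" using l2_mono[OF F(2) x(1)] x(2) by (auto simp: l2_ball_def)
    moreover have "(\<Sum>\<^sub>\<infinity>j\<in>J. A i j * x j) = y i" if "i \<in> F" for i
    proof -
      have "(\<Sum>\<^sub>\<infinity>j\<in>J. A i j * x j) = (\<Sum>\<^sub>\<infinity>j\<in>F. A i j * x j)"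
        by (rule infsum_cong_neutral) (use F x(1) in \<open>auto simp: l2_def\<close>)
      then show ?thesis using x(3)[OF that] F(1) by simp
    qed
    ultimately show "l2_ball J B \<inter> (\<Inter>i\<in>F. E i) \<noteq> {}" by (auto simp: E_def)
  qed
  then obtain x where "x \<in> l2_ball J B" "\<And>i. i \<in> J \<Longrightarrow> x \<in> E i" by blast
  then show ?thesis by (intro bexI[of _ x]) (auto simp: E_def l2_ball_def)
qed

section \<open>Invertibility from a uniform lower bound\<close>

lemma sub_invertible_if_bounded_below_onto:
  assumes M: "l2_matrix J A" and "0 < c"
    and lower: "\<And>x. x \<in> l2 J \<Longrightarrow> c * l2_norm J x \<le> l2_norm J (sub_apply J A x)"
    and onto: "\<And>y. y \<in> l2 J \<Longrightarrow> \<exists>x\<in>l2 J. sub_apply J A x = y"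
  shows "sub_invertible J A"
proof -
  have r: "rows_summable J A" and m: "\<And>x. x \<in> l2 J \<Longrightarrow> sub_apply J A x \<in> l2 J"
    using M by (auto simp: l2_matrix_def bounded_op_def)
  have inj: "inj_on (sub_apply J A) (l2 J)"
  proof
    fix x y assume xy: "x \<in> l2 J" "y \<in> l2 J" and eq: "sub_apply J A x = sub_apply J A y"
    have "sub_apply J A (\<lambda>i. x i - y i) = (\<lambda>_. 0)"
      using sub_apply_diff[OF r xy] eq by (simp add: fun_eq_iff)
    then have "c * l2_norm J (\<lambda>i. x i - y i) \<le> 0"
      using lower[OF l2_diff[OF xy]] by (simp add: l2_norm_def)
    then have "(\<lambda>i. x i - y i) = (\<lambda>_. 0)"
      using \<open>0 < c\<close> by (intro l2_norm_zero_imp_zero[OF l2_diff[OF xy]]) (simp add: mult_le_0_iff)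
    then show "x = y" by (simp add: fun_eq_iff)
  qed
  define T where "T = inv_into (l2 J) (sub_apply J A)"
  have TA: "T (sub_apply J A x) = x" if "x \<in> l2 J" for x
    using inj that by (simp add: T_def)
  have img: "y \<in> sub_apply J A ` l2 J" if "y \<in> l2 J" for y
    using onto[OF that] by blast
  have T: "T y \<in> l2 J" "sub_apply J A (T y) = y" if "y \<in> l2 J" for y
    using img[OF that] unfolding T_def by (rule inv_into_into, rule f_inv_into_f)
  have "bounded_op J T"
    unfolding bounded_op_def
  proof (intro conjI ballI allI)
    fix x y assume xy: "x \<in> l2 J" "y \<in> l2 J"
    have "sub_apply J A (\<lambda>i. T x i + T y i) = (\<lambda>i. x i + y i)"
      using sub_apply_add[OF r T(1)[OF xy(1)] T(1)[OF xy(2)]] T(2) xy by simp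
    then show "T (\<lambda>i. x i + y i) = (\<lambda>i. T x i + T y i)"
      using TA[OF l2_add[OF T(1)[OF xy(1)] T(1)[OF xy(2)]]] by simp
  next
    fix a x assume x: "x \<in> l2 J"
    have "sub_apply J A (\<lambda>i. a * T x i) = (\<lambda>i. a * x i)"
      by (simp add: sub_apply_scale T x)
    then show "T (\<lambda>i. a * x i) = (\<lambda>i. a * T x i)"
      using TA[OF l2_scale[OF T(1)[OF x], of a]] by simp
  next
    show "\<exists>C. \<forall>x\<in>l2 J. l2_norm J (T x) \<le> C * l2_norm J x"
    proof (intro exI[of _ "1 / c"] ballI)
      fix x assume "x \<in> l2 J"
      then show "l2_norm J (T x) \<le> 1 / c * l2_norm J x"
        using lower[OF T(1)] T(2) \<open>0 < c\<close> by (simp add: field_simps)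
    qed
  qed (use T in auto)
  then show ?thesis
    unfolding sub_invertible_def using M TA T(2) by blast
qed

text \<open>The lower bound on the finite sub-matrices is used twice: it gives their injectivity, hence
  solvability of the finite systems, and it keeps the solutions in one ball.\<close>

lemma onto_if_sections_bounded_below:
  assumes M: "l2_matrix J A" and "0 < c"
    and lower: "\<And>F x. finite F \<Longrightarrow> F \<subseteq> J \<Longrightarrow> x \<in> l2 F \<Longrightarrow>
                  c * l2_norm F x \<le> l2_norm F (sub_apply F A x)"
    and y: "y \<in> l2 J"
  shows "\<exists>x\<in>l2 J. sub_apply J A x = y"
proof -
  have "\<exists>x\<in>l2 J. \<forall>i\<in>J. (\<Sum>\<^sub>\<infinity>j\<in>J. A i j * x j) = y i"
  proof (rule solution_from_finite_sections[where B = "l2_norm J y / c"])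
    fix F assume F: "finite F" "F \<subseteq> J"
    have "\<exists>x. (\<forall>i. i \<notin> F \<longrightarrow> x i = 0) \<and> (\<forall>i\<in>F. (\<Sum>j\<in>F. A i j * x j) = y i)"
    proof (rule finite_section_solvable[OF F(1)])
      fix G z
      assume "G \<subseteq> F" and z: "\<And>i. i \<notin> G \<Longrightarrow> z i = 0" "\<And>i. i \<in> G \<Longrightarrow> (\<Sum>j\<in>G. A i j * z j) = 0"
      then have G: "finite G" "G \<subseteq> J" using F by (auto intro: finite_subset)
      have zl: "z \<in> l2 G" using l2_finite_support(1)[OF G(1)] z(1) by blast
      have "sub_apply G A z = (\<lambda>_. 0)" using z(2) G(1) by (auto simp: sub_apply_def fun_eq_iff)
      then have "c * l2_norm G z \<le> 0" using lower[OF G zl] by (simp add: l2_norm_def)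
      then show "z = (\<lambda>_. 0)"
        using \<open>0 < c\<close> by (intro l2_norm_zero_imp_zero[OF zl]) (simp add: mult_le_0_iff)
    qed
    then obtain x where x: "\<And>i. i \<notin> F \<Longrightarrow> x i = 0" "\<And>i. i \<in> F \<Longrightarrow> (\<Sum>j\<in>F. A i j * x j) = y i"
      by blast
    have xl: "x \<in> l2 F" using l2_finite_support(1)[OF F(1)] x(1) by blast
    have "sub_apply F A x = (\<lambda>i. if i \<in> F then y i else 0)"
      using x(2) F(1) by (auto simp: sub_apply_def fun_eq_iff)
    then have "c * l2_norm F x \<le> l2_norm J y"
      using lower[OF F xl] l2_restrict(2)[OF F(2) y] by simp
    then have "l2_norm F x \<le> l2_norm J y / c" using \<open>0 < c\<close> by (simp add: field_simps)
    then show "\<exists>x\<in>l2 F. l2_norm F x \<le> l2_norm J y / c \<and> (\<forall>i\<in>F. (\<Sum>j\<in>F. A i j * x j) = y i)"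
      using xl x(2) by blast
  qed (rule row_square_summable[OF M])
  then obtain x where x: "x \<in> l2 J" "\<And>i. i \<in> J \<Longrightarrow> (\<Sum>\<^sub>\<infinity>j\<in>J. A i j * x j) = y i"
    by blast
  have "sub_apply J A x = y" using x(2) y by (auto simp: sub_apply_def l2_def fun_eq_iff)
  with x(1) show ?thesis by blast
qed

lemma class_W_if_stable_samples:
  assumes r: "rows_summable I A" and st: "samples_uniformly_bounded I A"
  shows "A \<in> class_W I"
proof -
  obtain c C where "0 < c" and st:
    "\<And>J x. J \<subseteq> I \<Longrightarrow> x \<in> l2 I \<Longrightarrow> samples I A J x \<in> l2 I \<and>
       c * l2_norm I x \<le> l2_norm I (samples I A J x) \<and>
       l2_norm I (samples I A J x) \<le> C * l2_norm I x"
    using st unfolding samples_uniformly_bounded_def by blast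
  have full: "sub_apply I A x \<in> l2 I \<and> l2_norm I (sub_apply I A x) \<le> C * l2_norm I x"
    if "x \<in> l2 I" for x
    using st[of I x] that samples_eq_sub_apply[of I I x A] by simp
  have M: "l2_matrix I A"
    unfolding l2_matrix_def bounded_op_def
    using r full sub_apply_add[OF r] sub_apply_scale by blast
  have lower: "c * l2_norm J x \<le> l2_norm J (sub_apply J A x)" if J: "J \<subseteq> I" and x: "x \<in> l2 J" for J x
  proof -
    have MJ: "sub_apply J A x \<in> l2 J"
      using l2_matrix_sub[OF M J] x by (auto simp: l2_matrix_def bounded_op_def)
    show ?thesis
      using st[OF J l2_mono(1)[OF J x]] samples_eq_sub_apply[OF J x, of A]
        l2_mono(2)[OF J x] l2_mono(2)[OF J MJ] by simp
  qed
  have "sub_invertible J A" if J: "J \<subseteq> I" for J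
  proof (rule sub_invertible_if_bounded_below_onto[OF l2_matrix_sub[OF M J] \<open>0 < c\<close> lower[OF J]])
    fix y assume y: "y \<in> l2 J"
    show "\<exists>x\<in>l2 J. sub_apply J A x = y"
    proof (rule onto_if_sections_bounded_below[OF l2_matrix_sub[OF M J] \<open>0 < c\<close> _ y])
      fix F x assume "finite F" "F \<subseteq> J" "x \<in> l2 F"
      then show "c * l2_norm F x \<le> l2_norm F (sub_apply F A x)" using J by (intro lower) auto
    qed
  qed
  with M show ?thesis by (simp add: class_W_def)
qed

section \<open>Recovery from the samples\<close>

lemma inj_on_samples_if_class_W:
  assumes "A \<in> class_W I" "J \<subseteq> I"
  shows "inj_on (samples I A J) (l2 I)"
proof
  fix x y assume xy: "x \<in> l2 I" "y \<in> l2 I" and eq: "samples I A J x = samples I A J y"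
  have r: "rows_summable I A" and inv: "sub_invertible J A"
    using assms by (auto simp: class_W_def l2_matrix_def)
  obtain T where T: "\<And>z. z \<in> l2 J \<Longrightarrow> T (sub_apply J A z) = z"
    using inv by (auto simp: sub_invertible_def)
  have pt: "(if j \<in> J then sub_apply I A x j else x j) = (if j \<in> J then sub_apply I A y j else y j)" for j
    using fun_cong[OF eq, of j] by (simp add: samples_def)
  define z where "z = (\<lambda>i. x i - y i)"
  have z: "z = (\<lambda>i. if i \<in> J then z i else 0)"
  proof
    fix i
    show "z i = (if i \<in> J then z i else 0)" using pt[of i] by (simp add: z_def split: if_splits)
  qed
  have "z \<in> l2 I" unfolding z_def by (rule l2_diff[OF xy])
  then have zJ: "z \<in> l2 J" by (subst z) (rule l2_restrict(1)[OF assms(2)])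
  have "sub_apply I A z j = 0" if "j \<in> J" for j
    using sub_apply_diff[OF r xy] pt[of j] that by (simp add: z_def)
  then have "sub_apply J A z = (\<lambda>_. 0)"
    using sub_apply_eq_restrict[OF assms(2) zJ, of A] by (auto simp: fun_eq_iff)
  moreover have "(\<lambda>_. 0) \<in> l2 J" by (simp add: l2_def)
  moreover have "sub_apply J A (\<lambda>_. 0) = (\<lambda>_. 0)" by (simp add: sub_apply_def fun_eq_iff)
  ultimately have "z = (\<lambda>_. 0)" using T[OF zJ] T[of "\<lambda>_. 0"] by simp
  then show "x = y" by (simp add: z_def fun_eq_iff)
qed

theorem proposition3p5:
  fixes I :: "'i set" and A :: "'i \<Rightarrow> 'i \<Rightarrow> complex"
  assumes "countable I"
  shows "(A \<in> class_W I \<longrightarrow>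
            (\<forall>J\<subseteq>I. \<exists>R. \<forall>x\<in>l2 I. R (samples I A J x) = x)) \<and>
         (rows_summable I A \<and>
          (\<forall>J\<subseteq>I. inj_on (samples I A J) (l2 I)) \<and>
          samples_uniformly_bounded I A \<longrightarrow>
            A \<in> class_W I)"
proof (intro conjI impI allI)
  fix J assume "A \<in> class_W I" "J \<subseteq> I"
  then have "inj_on (samples I A J) (l2 I)" by (rule inj_on_samples_if_class_W)
  then show "\<exists>R. \<forall>x\<in>l2 I. R (samples I A J x) = x"
    by (meson inv_into_f_f)
next
  assume "rows_summable I A \<and> (\<forall>J\<subseteq>I. inj_on (samples I A J) (l2 I)) \<and>
    samples_uniformly_bounded I A"
  then show "A \<in> class_W I" by (blast intro: class_W_if_stable_samples)
qed

end
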